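(* Let $n\ge2$. There is a bijection between the set $\widehat{\mathscr D}^{\mathrm i}(n+2)$ of i-isomorphism classes of diagonalizable singular quadratic Lie algebra structures on $\mathbb C^{n+2}$ and the set of semi-simple $\mathrm O(n)$-orbits in $\mathbb P^1(\mathfrak o(n))$. The same result holds for the set $\widehat{\mathscr D}^{\mathrm i}_{\mathrm{red}}(n+2)$ of i-isomorphism classes of reduced diagonalizable structures and the set of semi-simple invertible $\mathrm O(n)$-orbits in $\mathbb P^1(\mathfrak o(n))$.
   Context: All vector spaces are finite-dimensional over $\mathbb C$. $\mathbb C^n$ carries its canonical non-degenerate symmetric bilinear form, $\mathrm O(n)$ is its isometry group and $\mathfrak o(n)$ the Lie algebra of skew-symmetric maps; $\mathrm O(n)$ acts on the projective space $\mathbb P^1(\mathfrak o(n))$ of lines of $\mathfrak o(n)$ by $U\cdot[C]=[UCU^{-1}]$. An orbit of $[C]$ is semi-simple (resp. semi-simple invertible) if $C\ne0$ is diagonalizable (resp. diagonalizable and invertible). A quadratic Lie algebra $(\mathfrak g,B)$ is a Lie algebra with a non-degenerate symmetric invariant bilinear form. An i-isomorphism is a Lie algebra isomorphism that is an isometry. Let $I(X,Y,Z)=B([X,Y],Z)$ and $\mathrm{dup}(\mathfrak g)=\dim\{\alpha\in\mathfrak g^*\mid\alpha\wedge I=0\}$; a non-Abelian quadratic Lie algebra is singular if $\mathrm{dup}(\mathfrak g)\ge1$. A quadratic Lie algebra $\mathfrak g\ne\{0\}$ is reduced if its center is totally isotropic. A quadratic Lie algebra structure on $\mathbb C^{n+2}$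 is a Lie bracket for which the canonical form is invariant. Every solvable singular quadratic Lie algebra is a double extension: it has an orthogonal decomposition $\mathfrak g=(\mathbb CX_0\oplus\mathbb CY_0)\oplus\mathfrak q$ with $B(X_0,X_0)=B(Y_0,Y_0)=0$, $B(X_0,Y_0)=1$, and bracket $[X+\lambda X_0+\mu Y_0,\,Y+\lambda'X_0+\mu'Y_0]=\mu\overline C(Y)-\mu'\overline C(X)+B(\overline C(X),Y)X_0$ ($X,Y\in\mathfrak q$), where $\overline C=\mathrm{ad}(Y_0)|_{\mathfrak q}$ is skew-symmetric. A solvable singular quadratic Lie algebra $\mathfrak g$ is called diagonalizable if $\overline C$ is diagonalizable (this does not depend on the decomposition). *)

theory Defs
  imports "HOL-Analysis.Analysis" "HOL-Library.Function_Algebras"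
begin

text \<open>
  All vector spaces are subspaces of some \<open>complex ^ 'k\<close>, with complex scalar multiplication
  \<open>(*s)\<close>; notions such as span, subspace and dimension are therefore the \<open>vec\<close> ones and not
  the real ones. Linear maps are plain functions satisfying \<open>Vector_Spaces.linear (*s) (*s)\<close>.
\<close>

type_synonym 'v form = "'v \<Rightarrow> 'v \<Rightarrow> complex"
type_synonym 'v bracket = "'v \<Rightarrow> 'v \<Rightarrow> 'v"

definition canonical_form :: "(complex ^ 'k) form" where
  "canonical_form x y = (\<Sum>i\<in>UNIV. x $ i * y $ i)"

definition lie_bracket :: "(complex ^ 'k) bracket \<Rightarrow> bool" where
  "lie_bracket br \<longleftrightarrow>
     (\<forall>x. Vector_Spaces.linear (*s) (*s) (br x)) \<and>
     (\<forall>y. Vector_Spaces.linear (*s) (*s) (\<lambda>x. br x y)) \<and>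
     (\<forall>x. br x x = 0) \<and>
     (\<forall>x y z. br x (br y z) + br y (br z x) + br z (br x y) = 0)"

definition nondeg_symmetric_bilinear :: "(complex ^ 'k) form \<Rightarrow> bool" where
  "nondeg_symmetric_bilinear B \<longleftrightarrow>
     (\<forall>x. Vector_Spaces.linear (*s) (*) (B x)) \<and>
     (\<forall>x y. B x y = B y x) \<and>
     (\<forall>x. (\<forall>y. B x y = 0) \<longrightarrow> x = 0)"

definition quadratic_lie_algebra :: "(complex ^ 'k) form \<Rightarrow> (complex ^ 'k) bracket \<Rightarrow> bool" where
  "quadratic_lie_algebra B br \<longleftrightarrow>
     lie_bracket br \<and> nondeg_symmetric_bilinear B \<and>
     (\<forall>x y z. B (br x y) z = B x (br y z))"

definition i_isomorphic ::
    "(complex ^ 'k) form \<Rightarrow> (complex ^ 'k) bracket \<Rightarrow> (complex ^ 'l) form \<Rightarrow> (complex ^ 'l) bracket \<Rightarrow> bool"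
  where
  "i_isomorphic B br B' br' \<longleftrightarrow>
     (\<exists>T. Vector_Spaces.linear (*s) (*s) T \<and> bij T \<and>
          (\<forall>x y. T (br x y) = br' (T x) (T y)) \<and>
          (\<forall>x y. B' (T x) (T y) = B x y))"

definition three_form ::
    "(complex ^ 'k) form \<Rightarrow> (complex ^ 'k) bracket \<Rightarrow> complex ^ 'k \<Rightarrow> complex ^ 'k \<Rightarrow> complex ^ 'k \<Rightarrow> complex"
  where
  "three_form B br x y z = B (br x y) z"

text \<open>Wedge product of a linear form with an alternating 3-form (a sum over (1,3)-shuffles).\<close>

definition wedge_1_3 ::
    "('v \<Rightarrow> complex) \<Rightarrow> ('v \<Rightarrow> 'v \<Rightarrow> 'v \<Rightarrow> complex) \<Rightarrow> 'v \<Rightarrow> 'v \<Rightarrow> 'v \<Rightarrow> 'v \<Rightarrow> complex"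
  where
  "wedge_1_3 \<alpha> \<omega> x y z w = \<alpha> x * \<omega> y z w - \<alpha> y * \<omega> x z w + \<alpha> z * \<omega> x y w - \<alpha> w * \<omega> x y z"

text \<open>
  The dual space is a subspace of the complex vector space of all functions into the complex
  numbers, with the pointwise operations; \<open>dup\<close> is a dimension in that space.
\<close>

definition fun_scale :: "complex \<Rightarrow> ('v \<Rightarrow> complex) \<Rightarrow> 'v \<Rightarrow> complex" where
  "fun_scale c \<alpha> = (\<lambda>x. c * \<alpha> x)"

lemma vector_space_fun_scale: "vector_space fun_scale"
  by unfold_locales (auto simp: fun_scale_def plus_fun_def algebra_simps)

definition dup :: "(complex ^ 'k) form \<Rightarrow> (complex ^ 'k) bracket \<Rightarrow> nat" where
  "dup B br = vector_space.dim fun_scale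
     {\<alpha>. Vector_Spaces.linear (*s) (*) \<alpha> \<and> (\<forall>x y z w. wedge_1_3 \<alpha> (three_form B br) x y z w = 0)}"

definition abelian :: "(complex ^ 'k) bracket \<Rightarrow> bool" where
  "abelian br \<longleftrightarrow> (\<forall>x y. br x y = 0)"

definition singular :: "(complex ^ 'k) form \<Rightarrow> (complex ^ 'k) bracket \<Rightarrow> bool" where
  "singular B br \<longleftrightarrow> quadratic_lie_algebra B br \<and> \<not> abelian br \<and> dup B br \<ge> 1"

definition center :: "(complex ^ 'k) bracket \<Rightarrow> (complex ^ 'k) set" where
  "center br = {x. \<forall>y. br x y = 0}"

definition reduced :: "(complex ^ 'k) form \<Rightarrow> (complex ^ 'k) bracket \<Rightarrow> bool" where
  "reduced B br \<longleftrightarrow>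
     quadratic_lie_algebra B br \<and> (UNIV :: (complex ^ 'k) set) \<noteq> {0} \<and>
     (\<forall>x\<in>center br. \<forall>y\<in>center br. B x y = 0)"

primrec derived_series :: "(complex ^ 'k) bracket \<Rightarrow> nat \<Rightarrow> (complex ^ 'k) set" where
  "derived_series br 0 = UNIV"
| "derived_series br (Suc k) =
     vec.span {br x y | x y. x \<in> derived_series br k \<and> y \<in> derived_series br k}"

definition solvable :: "(complex ^ 'k) bracket \<Rightarrow> bool" where
  "solvable br \<longleftrightarrow> (\<exists>k. derived_series br k = {0})"

definition diagonalizable_on :: "(complex ^ 'k) set \<Rightarrow> (complex ^ 'k \<Rightarrow> complex ^ 'k) \<Rightarrow> bool" where
  "diagonalizable_on V f \<longleftrightarrow>
     (\<exists>b. vec.independent b \<and> vec.span b = V \<and> (\<forall>v\<in>b. \<exists>c. f v = c *s v))"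

text \<open>
  The double extension decomposition. The skew-symmetric map of the decomposition is the
  restriction of \<open>ad Y0 = br Y0\<close> to \<open>q\<close>.
\<close>

definition double_extension_decomposition ::
    "(complex ^ 'k) form \<Rightarrow> (complex ^ 'k) bracket \<Rightarrow> complex ^ 'k \<Rightarrow> complex ^ 'k \<Rightarrow> (complex ^ 'k) set \<Rightarrow> bool"
  where
  "double_extension_decomposition B br X0 Y0 q \<longleftrightarrow>
     B X0 X0 = 0 \<and> B Y0 Y0 = 0 \<and> B X0 Y0 = 1 \<and>
     vec.subspace q \<and>
     (\<forall>x\<in>q. B x X0 = 0 \<and> B x Y0 = 0) \<and>
     vec.span {X0, Y0} \<inter> q = {0} \<and>
     (\<forall>v. \<exists>u\<in>vec.span {X0, Y0}. \<exists>x\<in>q. v = u + x) \<and>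
     (\<forall>x\<in>q. br Y0 x \<in> q) \<and>
     (\<forall>x\<in>q. \<forall>y\<in>q. B (br Y0 x) y = - B x (br Y0 y)) \<and>
     (\<forall>x\<in>q. \<forall>y\<in>q. \<forall>l m l' m'.
        br (x + l *s X0 + m *s Y0) (y + l' *s X0 + m' *s Y0) =
          m *s br Y0 y - m' *s br Y0 x + B (br Y0 x) y *s X0)"

definition diagonalizable_singular :: "(complex ^ 'k) form \<Rightarrow> (complex ^ 'k) bracket \<Rightarrow> bool" where
  "diagonalizable_singular B br \<longleftrightarrow>
     singular B br \<and> solvable br \<and>
     (\<exists>X0 Y0 q. double_extension_decomposition B br X0 Y0 q \<and> diagonalizable_on q (br Y0))"

definition i_iso_rel :: "((complex ^ 'k) bracket \<times> (complex ^ 'k) bracket) set" where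
  "i_iso_rel = {(br, br'). i_isomorphic canonical_form br canonical_form br'}"

definition diag_structures :: "(complex ^ 'k) bracket set" where
  "diag_structures = {br. diagonalizable_singular canonical_form br}"

definition diag_classes :: "(complex ^ 'k) bracket set set" where
  "diag_classes = diag_structures // (i_iso_rel \<inter> diag_structures \<times> diag_structures)"

definition reduced_diag_structures :: "(complex ^ 'k) bracket set" where
  "reduced_diag_structures = {br \<in> diag_structures. reduced canonical_form br}"

definition reduced_diag_classes :: "(complex ^ 'k) bracket set set" where
  "reduced_diag_classes = reduced_diag_structures //
     (i_iso_rel \<inter> reduced_diag_structures \<times> reduced_diag_structures)"

definition orthogonal_grp :: "(complex ^ 'k \<Rightarrow> complex ^ 'k) set" where
  "orthogonal_grp = {U. Vector_Spaces.linear (*s) (*s) U \<and> bij U \<and>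
     (\<forall>x y. canonical_form (U x) (U y) = canonical_form x y)}"

definition skew_maps :: "(complex ^ 'k \<Rightarrow> complex ^ 'k) set" where
  "skew_maps = {C. Vector_Spaces.linear (*s) (*s) C \<and>
     (\<forall>x y. canonical_form (C x) y = - canonical_form x (C y))}"

definition map_line :: "(complex ^ 'k \<Rightarrow> complex ^ 'k) \<Rightarrow> (complex ^ 'k \<Rightarrow> complex ^ 'k) set" where
  "map_line C = range (\<lambda>c x. c *s C x)"

definition proj_skew :: "(complex ^ 'k \<Rightarrow> complex ^ 'k) set set" where
  "proj_skew = {map_line C | C. C \<in> skew_maps \<and> C \<noteq> (\<lambda>x. 0)}"

definition line_conj ::
    "(complex ^ 'k \<Rightarrow> complex ^ 'k) \<Rightarrow> (complex ^ 'k \<Rightarrow> complex ^ 'k) set \<Rightarrow> (complex ^ 'k \<Rightarrow> complex ^ 'k) set"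
  where
  "line_conj U L = (\<lambda>C. U \<circ> C \<circ> inv U) ` L"

definition line_orbit ::
    "(complex ^ 'k \<Rightarrow> complex ^ 'k) set \<Rightarrow> (complex ^ 'k \<Rightarrow> complex ^ 'k) set set" where
  "line_orbit L = {line_conj U L | U. U \<in> orthogonal_grp}"

definition semisimple_orbits :: "(complex ^ 'k \<Rightarrow> complex ^ 'k) set set set" where
  "semisimple_orbits = {line_orbit L | L. L \<in> proj_skew \<and>
     (\<exists>C. L = map_line C \<and> C \<noteq> (\<lambda>x. 0) \<and> diagonalizable_on UNIV C)}"

definition semisimple_invertible_orbits :: "(complex ^ 'k \<Rightarrow> complex ^ 'k) set set set" where
  "semisimple_invertible_orbits = {line_orbit L | L. L \<in> proj_skew \<and>
     (\<exists>C. L = map_line C \<and> C \<noteq> (\<lambda>x. 0) \<and> diagonalizable_on UNIV C \<and> bij C)}"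

end

theory Submission
  imports Defs
begin

text \<open>
  The bijection sends a structure to the orbit of the line of its skew map \<open>C = ad Y0\<close>. To compare maps
  that live on different subspaces, decompositions are described by frames: a hyperbolic pair \<open>X\<close>, \<open>Y\<close>
  with an isometric embedding \<open>J\<close> of the small space, of dimension \<open>n\<close>, onto the orthogonal complement of the pair.
  Since the complex numbers are algebraically closed, orthonormal sets extend to bases, and so every
  hyperbolic pair belongs to a frame (\<open>hyperbolic_pair_frame\<close>).

  Along a frame, the double extension of a skew map is a quadratic Lie algebra whose three-form has the
  linear factor \<open>v \<mapsto> v \<cdot> X\<close>; it is diagonalizable singular if the map is nonzero and diagonalizable.
  Conversely every diagonalizable singular structure arises in this way (\<open>diag_structures_presents\<close>).

  It remains to see when two maps give i-isomorphic structures. Any two frames are related by an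
  isometry, and conjugating or rescaling the map is a change of frame for the same bracket, so maps
  with the same orbit of lines give isomorphic structures. In the other direction, a diagonalizable
  skew map satisfies \<open>ker C \<inter> im C = 0\<close>. The derived algebra is spanned by \<open>X\<close> and \<open>im C\<close>, the center by
  \<open>X\<close> and \<open>ker C\<close>, so they meet exactly in the line of \<open>X\<close>. An i-isomorphism preserves this line, hence
  its orthogonal space and the quotient of that space by the line; this quotient is isometric to the
  small space, and the isometry induced there conjugates one map to a multiple of the other
  (\<open>equal_double_ext_conjugate\<close>).

  The description of the center also shows that a structure is reduced if and only if its skew map is
  invertible (\<open>presents_reduced_iff\<close>), which gives the second bijection.
\<close>

section \<open>Complex linear maps and the canonical form\<close>

abbreviation cdot :: "complex ^ 'k \<Rightarrow> complex ^ 'k \<Rightarrow> complex" (infix "\<cdot>" 70)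
  where "x \<cdot> y \<equiv> canonical_form x y"

abbreviation clinear :: "(complex ^ 'k \<Rightarrow> complex ^ 'l) \<Rightarrow> bool"
  where "clinear f \<equiv> Vector_Spaces.linear (*s) (*s) f"

lemma clinear_iff:
  "clinear f \<longleftrightarrow> (\<forall>x y. f (x + y) = f x + f y) \<and> (\<forall>c x. f (c *s x) = c *s f x)"
  using Vector_Spaces.linear_iff[of "(*s)" "(*s)" f]
  by (auto intro: vec.vector_space_axioms)

lemma clinear_functional_iff:
  "Vector_Spaces.linear (*s) (*) \<phi> \<longleftrightarrow>
     (\<forall>x y. \<phi> (x + y) = \<phi> x + \<phi> y) \<and> (\<forall>c x. \<phi> (c *s x) = c * \<phi> (x :: complex ^ 'k))"
  using Vector_Spaces.linear_iff[of "(*s)" "(*)" \<phi>]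
  by (auto intro: vec.vector_space_axioms vector_space_over_itself.vector_space_axioms)

lemma clinear_add: "clinear f \<Longrightarrow> f (x + y) = f x + f y"
  and clinear_scale: "clinear f \<Longrightarrow> f (c *s x) = c *s f x"
  by (simp_all add: clinear_iff)

lemma clinear_zero: "clinear f \<Longrightarrow> f 0 = 0"
  using clinear_scale[of f 0 0] by simp

lemma clinear_minus: "clinear f \<Longrightarrow> f (- x) = - f x"
  using clinear_scale[of f "-1" x] by simp

lemma clinear_diff: "clinear f \<Longrightarrow> f (x - y) = f x - f y"
  using clinear_add[of f x "- y"] by (simp add: clinear_minus)

lemmas clinear_simps = clinear_add clinear_scale clinear_zero clinear_minus clinear_diff

lemma clinear_compose: "clinear f \<Longrightarrow> clinear g \<Longrightarrow> clinear (f \<circ> g)"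
  by (simp add: clinear_iff)

lemma clinear_inv: "clinear f \<Longrightarrow> bij f \<Longrightarrow> clinear (inv f)"
  unfolding clinear_iff by (metis bij_inv_eq_iff)

lemma subspace_range: "clinear f \<Longrightarrow> vec.subspace (range f)"
  by (intro vec.linear_subspace_image) auto

lemma cdot_commute: "x \<cdot> y = y \<cdot> x"
  by (simp add: canonical_form_def mult.commute)

lemma cdot_add_left: "(x + y) \<cdot> z = x \<cdot> z + y \<cdot> z"
  and cdot_add_right: "z \<cdot> (x + y) = z \<cdot> x + z \<cdot> y"
  by (simp_all add: canonical_form_def algebra_simps sum.distrib)

lemma cdot_scale_left: "(c *s x) \<cdot> z = c * (x \<cdot> z)"
  and cdot_scale_right: "z \<cdot> (c *s x) = c * (z \<cdot> x)"
  by (simp_all add: canonical_form_def algebra_simps sum_distrib_left)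

lemma cdot_zero: "0 \<cdot> z = 0" "z \<cdot> 0 = 0"
  by (simp_all add: canonical_form_def)

lemma cdot_minus: "(- x) \<cdot> z = - (x \<cdot> z)" "z \<cdot> (- x) = - (z \<cdot> x)"
  by (simp_all add: canonical_form_def sum_negf)

lemma cdot_diff: "(x - y) \<cdot> z = x \<cdot> z - y \<cdot> z" "z \<cdot> (x - y) = z \<cdot> x - z \<cdot> y"
  by (simp_all add: canonical_form_def algebra_simps sum_subtractf)

lemmas cdot_simps =
  cdot_add_left cdot_add_right cdot_scale_left cdot_scale_right cdot_zero cdot_minus cdot_diff

lemma cdot_sum_left: "(\<Sum>i\<in>S. f i) \<cdot> z = (\<Sum>i\<in>S. f i \<cdot> z)"
  by (induction S rule: infinite_finite_induct) (auto simp: cdot_simps)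

lemma cdot_sum_right: "z \<cdot> (\<Sum>i\<in>S. f i) = (\<Sum>i\<in>S. z \<cdot> f i)"
  by (induction S rule: infinite_finite_induct) (auto simp: cdot_simps)

lemma cdot_axis: "x \<cdot> axis i 1 = x $ i"
  unfolding canonical_form_def axis_def
  by (simp add: if_distrib sum.delta cong: if_cong)

lemma cdot_nondegenerate: "(\<And>y. x \<cdot> y = 0) \<Longrightarrow> x = 0"
  by (metis cdot_axis vec_eq_iff zero_index)

lemma cdot_eqI: "(\<And>z. x \<cdot> z = y \<cdot> z) \<Longrightarrow> x = y"
  using cdot_nondegenerate[of "x - y"] by (simp add: cdot_simps)

section \<open>Orthonormal sets for the complex symmetric form\<close>

definition orthonormal :: "(complex ^ 'k) set \<Rightarrow> bool" where
  "orthonormal S \<longleftrightarrow> (\<forall>x\<in>S. \<forall>y\<in>S. x \<cdot> y = (if x = y then 1 else 0))"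

lemma independent_orthonormal:
  assumes "orthonormal S" shows "vec.independent S"
  unfolding vec.independent_explicit_finite_subsets
proof (intro allI impI ballI)
  fix T u v assume T: "T \<subseteq> S" "finite T" "(\<Sum>v\<in>T. u v *s v) = 0" "v \<in> T"
  have "0 = (\<Sum>w\<in>T. u w *s w) \<cdot> v"
    using T by (simp add: cdot_zero)
  also have "\<dots> = (\<Sum>w\<in>T. if w = v then u w else 0)"
    using T assms unfolding cdot_sum_left cdot_scale_left orthonormal_def
    by (intro sum.cong) (auto simp: subset_iff)
  also have "\<dots> = u v"
    using T by simp
  finally show "u v = 0" by simp
qed

lemma finite_orthonormal: "orthonormal S \<Longrightarrow> finite S"
  using independent_orthonormal vec.finiteI_independent by blast

text \<open>
  The usual orthogonal projection: although the form has isotropic vectors, subtracting the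
  coefficients along an orthonormal set works as in a Euclidean space.
\<close>

lemma cdot_orthogonal_part:
  assumes "orthonormal S" "s \<in> S"
  shows "(u - (\<Sum>t\<in>S. (u \<cdot> t) *s t)) \<cdot> s = 0"
proof -
  have "(\<Sum>t\<in>S. (u \<cdot> t) *s t) \<cdot> s = (\<Sum>t\<in>S. if t = s then u \<cdot> t else 0)"
    using assms unfolding cdot_sum_left cdot_scale_left orthonormal_def
    by (intro sum.cong) auto
  also have "\<dots> = u \<cdot> s"
    using assms finite_orthonormal[OF assms(1)] by simp
  finally show ?thesis by (simp add: cdot_simps)
qed

text \<open>
  The new vector needed to enlarge \<open>S\<close>. If every vector orthogonal to \<open>S\<close> were isotropic, then by
  polarization the form would vanish on that orthogonal complement. A nonzero vector of the
  complement would then be orthogonal to the complement and to \<open>S\<close>, that is, to everything,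
  contradicting non-degeneracy.
\<close>

lemma ex_anisotropic_orthogonal:
  fixes S :: "(complex ^ 'k) set"
  assumes S: "orthonormal S" and card: "card S < CARD('k)"
  obtains v where "\<And>s. s \<in> S \<Longrightarrow> v \<cdot> s = 0" "v \<cdot> v \<noteq> 0"
proof -
  define p where "p u = u - (\<Sum>t\<in>S. (u \<cdot> t) *s t)" for u
  have p: "p u \<cdot> s = 0" if "s \<in> S" for u s
    using cdot_orthogonal_part[OF S that] by (simp add: p_def)
  have "vec.span S \<noteq> UNIV"
    using vec.dim_le_card[of UNIV S] finite_orthonormal[OF S] card unfolding vec_dim_card by auto
  then obtain u where u: "u \<notin> vec.span S" by blast
  have "p u \<noteq> 0"
  proof
    assume "p u = 0"
    then have "u = (\<Sum>t\<in>S. (u \<cdot> t) *s t)" by (simp add: p_def)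
    also have "\<dots> \<in> vec.span S"
      by (intro vec.span_sum vec.span_scale vec.span_base)
    finally show False using u by simp
  qed
  have False if isotropic: "\<And>v. (\<And>s. s \<in> S \<Longrightarrow> v \<cdot> s = 0) \<Longrightarrow> v \<cdot> v = 0"
  proof -
    have "p u \<cdot> z = 0" for z
    proof -
      have "(p u + p z) \<cdot> (p u + p z) = 0" "p u \<cdot> p u = 0" "p z \<cdot> p z = 0"
        by (intro isotropic; simp add: p cdot_simps)+
      then have "p u \<cdot> p z = 0"
        using cdot_commute[of "p z" "p u"] by (simp add: cdot_simps)
      moreover have "p u \<cdot> (\<Sum>t\<in>S. (z \<cdot> t) *s t) = 0"
        by (simp add: cdot_sum_right cdot_simps p)
      ultimately show ?thesis
        by (simp add: p_def[of z] cdot_simps)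
    qed
    then show False
      using cdot_nondegenerate \<open>p u \<noteq> 0\<close> by blast
  qed
  then show ?thesis using that by blast
qed

text \<open>
  Any nonzero complex number has a square root, so an anisotropic vector can be normalized; this is
  where the complex field is essential.
\<close>

lemma extend_orthonormal:
  fixes S :: "(complex ^ 'k) set"
  assumes "orthonormal S"
  shows "\<exists>S'. orthonormal S' \<and> S \<subseteq> S' \<and> card S' = CARD('k)"
  using assms
proof (induction "CARD('k) - card S" arbitrary: S)
  case 0
  have "card S \<le> CARD('k)"
    using vec.independent_card_le_dim[OF _ independent_orthonormal[OF 0(2)], of UNIV]
    unfolding vec_dim_card by simp
  then show ?case using 0 by (intro exI[of _ S]) auto
next
  case (Suc k)
  then have "card S < CARD('k)" by linarith
  then obtain v where v: "\<And>s. s \<in> S \<Longrightarrow> v \<cdot> s = 0" "v \<cdot> v \<noteq> 0"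
    using ex_anisotropic_orthogonal[OF Suc.prems] by blast
  define w where "w = inverse (csqrt (v \<cdot> v)) *s v"
  have w: "w \<cdot> w = 1" "\<And>s. s \<in> S \<Longrightarrow> w \<cdot> s = 0"
  proof -
    have "csqrt (v \<cdot> v) * csqrt (v \<cdot> v) = v \<cdot> v"
      by (metis power2_csqrt power2_eq_square)
    moreover have "csqrt (v \<cdot> v) \<noteq> 0"
      using v by simp
    ultimately show "w \<cdot> w = 1"
      unfolding w_def cdot_scale_left cdot_scale_right by (metis field_class.field_inverse mult.left_commute mult.right_neutral)
    show "w \<cdot> s = 0" if "s \<in> S" for s
      using v(1)[OF that] by (simp add: w_def cdot_simps)
  qed
  have "w \<notin> S" using w by auto
  then have "card (insert w S) = Suc (card S)"
    using finite_orthonormal[OF Suc.prems] by simp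
  moreover have "orthonormal (insert w S)"
    using Suc.prems w \<open>w \<notin> S\<close> unfolding orthonormal_def
    by (metis cdot_commute insert_iff)
  moreover have "k = CARD('k) - Suc (card S)"
    using Suc.hyps(2) by simp
  ultimately show ?case
    using Suc.hyps(1)[of "insert w S"] by auto
qed

lemma orthonormal_expansion:
  fixes S :: "(complex ^ 'k) set"
  assumes S: "orthonormal S" and card: "card S = CARD('k)"
  shows "v = (\<Sum>t\<in>S. (v \<cdot> t) *s t)"
proof -
  have "vec.span S = UNIV"
    using vec.card_ge_dim_independent[of S UNIV] independent_orthonormal[OF S] card
    unfolding vec_dim_card by auto
  have "(v - (\<Sum>t\<in>S. (v \<cdot> t) *s t)) \<cdot> z = 0" for z
  proof -
    have "z \<in> vec.span S" using \<open>vec.span S = UNIV\<close> by simp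
    then show ?thesis
      by (rule vec.span_induct)
         (auto simp: vec.subspace_def cdot_simps(1-6) cdot_orthogonal_part[OF S])
  qed
  then show ?thesis
    using cdot_nondegenerate[of "v - (\<Sum>t\<in>S. (v \<cdot> t) *s t)"] by simp
qed

section \<open>Isometries\<close>

definition isometry :: "(complex ^ 'k \<Rightarrow> complex ^ 'l) \<Rightarrow> bool" where
  "isometry f \<longleftrightarrow> clinear f \<and> (\<forall>x y. f x \<cdot> f y = x \<cdot> y)"

lemma isometry_clinear: "isometry f \<Longrightarrow> clinear f"
  and isometry_cdot: "isometry f \<Longrightarrow> f x \<cdot> f y = x \<cdot> y"
  by (simp_all add: isometry_def)

lemma isometry_inj:
  assumes "isometry f" shows "inj f"
proof (rule injI, rule cdot_eqI)
  fix x y z assume "f x = f y"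
  then show "x \<cdot> z = y \<cdot> z"
    using isometry_cdot[OF assms, of x z] isometry_cdot[OF assms, of y z] by simp
qed

lemma isometry_bij:
  fixes f :: "complex ^ 'k \<Rightarrow> complex ^ 'k"
  assumes "isometry f" shows "bij f"
  by (simp add: bij_def isometry_inj[OF assms]
      vec.linear_inj_imp_surj[OF isometry_clinear[OF assms] isometry_inj[OF assms]])

lemma isometry_compose: "isometry f \<Longrightarrow> isometry g \<Longrightarrow> isometry (f \<circ> g)"
  by (auto simp: isometry_def intro: clinear_compose)

lemma orthogonal_grp_eq: "orthogonal_grp = Collect isometry"
proof (intro set_eqI iffI)
  fix f :: "complex ^ 'k \<Rightarrow> complex ^ 'k" assume "f \<in> Collect isometry"
  then have "isometry f" by simp
  then show "f \<in> orthogonal_grp"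
    using isometry_bij[of f] by (simp add: orthogonal_grp_def isometry_def)
qed (simp add: orthogonal_grp_def isometry_def)

lemma isometry_inv:
  fixes f :: "complex ^ 'k \<Rightarrow> complex ^ 'k"
  assumes f: "isometry f" shows "isometry (inv f)"
proof -
  have "f (inv f x) = x" for x
    using isometry_bij[OF f] by (simp add: bij_is_surj surj_f_inv_f)
  then have "inv f x \<cdot> inv f y = x \<cdot> y" for x y
    using isometry_cdot[OF f, of "inv f x" "inv f y"] by simp
  then show ?thesis
    using clinear_inv isometry_clinear[OF f] isometry_bij[OF f] by (simp add: isometry_def)
qed

section \<open>Frames\<close>

text \<open>
  A frame is an orthogonal splitting of the large space into a hyperbolic plane, spanned by the
  isotropic vectors \<open>X\<close> and \<open>Y\<close>, and a copy of the small space, embedded by the isometry \<open>J\<close>. Using the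
  embedding instead of a subspace \<open>q\<close> lets skew maps on different complements be compared on one
  fixed space.
\<close>

locale frame =
  fixes X Y :: "complex ^ 'm" and J :: "complex ^ 'n \<Rightarrow> complex ^ 'm"
  assumes XX: "X \<cdot> X = 0" and YY: "Y \<cdot> Y = 0" and XY: "X \<cdot> Y = 1"
    and isometry_J: "isometry J"
    and J_X: "J x \<cdot> X = 0" and J_Y: "J x \<cdot> Y = 0"
    and complete: "\<exists>x a b. v = J x + a *s X + b *s Y"

text \<open>
  A hyperbolic pair spans the same plane as an orthonormal pair \<open>e\<close>, \<open>f\<close>. An orthonormal basis that
  extends this pair has exactly as many other members as the small space has coordinates, and \<open>J\<close>
  sends the coordinate vectors to them.
\<close>

lemma hyperbolic_pair_frame:
  fixes X Y :: "complex ^ 'm"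
  assumes card: "CARD('m) = CARD('n) + 2"
    and XX: "X \<cdot> X = 0" and YY: "Y \<cdot> Y = 0" and XY: "X \<cdot> Y = 1"
  shows "\<exists>J :: complex ^ 'n \<Rightarrow> complex ^ 'm. frame X Y J"
proof -
  \<comment> \<open>Completing squares: \<open>X \<cdot> Y = 1\<close> makes both vectors unit vectors.\<close>
  define e f where "e = X + (1/2) *s Y" and "f = \<i> *s (X - (1/2) *s Y)"
  have YX: "Y \<cdot> X = 1" using XY by (simp add: cdot_commute)
  have ef: "e \<cdot> e = 1" "f \<cdot> f = 1" "e \<cdot> f = 0" "f \<cdot> e = 0"
    by (simp_all add: e_def f_def cdot_simps XX YY XY YX algebra_simps)
  have "e \<noteq> f" using ef by auto
  have "orthonormal {e, f}"
    using ef \<open>e \<noteq> f\<close> by (auto simp: orthonormal_def)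
  then obtain S where S: "orthonormal S" "e \<in> S" "f \<in> S" "card S = CARD('m)"
    using extend_orthonormal by (metis insert_subset)
  define S' where "S' = S - {e, f}"
  have fin: "finite S" "finite S'"
    using finite_orthonormal S(1) by (auto simp: S'_def)
  have "card S' = CARD('n)"
    unfolding S'_def using S card fin \<open>e \<noteq> f\<close> by (subst card_Diff_subset) auto
  then obtain h where h: "bij_betw h (UNIV :: 'n set) S'"
    using fin by (metis finite_class.finite_UNIV finite_same_card_bij)
  have "h i \<in> S'" for i
    using h by (auto simp: bij_betw_def)
  then have h_in: "h i \<in> S" "h i \<noteq> e" "h i \<noteq> f" for i
    by (auto simp: S'_def)
  have hS: "h i \<cdot> e = 0" "h i \<cdot> f = 0" for i
    using h_in[of i] S by (auto simp: orthonormal_def)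
  have hh: "h i \<cdot> h j = (if i = j then 1 else 0)" for i j
    using h S h_in[of i] h_in[of j] by (auto simp: bij_betw_def orthonormal_def inj_def)
  have X: "X = (1/2) *s e - (\<i>/2) *s f" and Y: "Y = e + \<i> *s f"
    by (simp_all add: e_def f_def vec_eq_iff algebra_simps)
  define J :: "complex ^ 'n \<Rightarrow> complex ^ 'm" where "J x = (\<Sum>i\<in>UNIV. x $ i *s h i)" for x
  have "clinear J"
    by (simp add: clinear_iff J_def sum.distrib vec.scale_left_distrib vec.scale_sum_right)
  have "J x \<cdot> J y = x \<cdot> y" for x y
  proof -
    have "J x \<cdot> J y = (\<Sum>i\<in>UNIV. \<Sum>j\<in>UNIV. if j = i then x $ i * y $ j else 0)"
      unfolding J_def cdot_sum_left cdot_sum_right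
      by (intro sum.cong) (auto simp: cdot_simps hh)
    then show ?thesis by (simp add: canonical_form_def)
  qed
  moreover have "J x \<cdot> X = 0" "J x \<cdot> Y = 0" for x
    by (simp_all add: J_def cdot_sum_left cdot_simps X Y hS)
  moreover have "\<exists>x a b. v = J x + a *s X + b *s Y" for v
  proof -
    have "v = (\<Sum>t\<in>S. (v \<cdot> t) *s t)" by (rule orthonormal_expansion) fact+
    also have "S = insert e (insert f S')" using S by (auto simp: S'_def)
    also have "(\<Sum>t\<in>\<dots>. (v \<cdot> t) *s t) = (\<Sum>t\<in>S'. (v \<cdot> t) *s t) + (v \<cdot> e) *s e + (v \<cdot> f) *s f"
      using fin \<open>e \<noteq> f\<close> by (simp add: S'_def)
    also have "(\<Sum>t\<in>S'. (v \<cdot> t) *s t) = J (\<chi> i. v \<cdot> h i)"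
      unfolding J_def using sum.reindex_bij_betw[OF h, of "\<lambda>t. (v \<cdot> t) *s t"] by simp
    finally have "v = J (\<chi> i. v \<cdot> h i) + (v \<cdot> e + \<i> * (v \<cdot> f)) *s X
        + ((1/2) * (v \<cdot> e) - (\<i>/2) * (v \<cdot> f)) *s Y"
      by (simp add: e_def f_def vec_eq_iff algebra_simps)
    then show ?thesis by blast
  qed
  ultimately have "frame X Y J"
    using \<open>clinear J\<close> XX YY XY by unfold_locales (auto simp: isometry_def)
  then show ?thesis by blast
qed

text \<open>
  For an isometric embedding \<open>J\<close> this is its adjoint: the orthogonal projection onto the range of \<open>J\<close>,
  read in the coordinates of the small space.
\<close>

definition coord :: "(complex ^ 'n \<Rightarrow> complex ^ 'm) \<Rightarrow> complex ^ 'm \<Rightarrow> complex ^ 'n" where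
  "coord J v = (\<chi> i. v \<cdot> J (axis i 1))"

lemma clinear_coord: "clinear (coord J)"
  by (simp add: clinear_iff coord_def vec_eq_iff cdot_simps)

lemmas coord_simps = clinear_simps[OF clinear_coord]

context frame
begin

lemma clinear_J: "clinear J"
  and J_cdot_J: "J x \<cdot> J y = x \<cdot> y"
  using isometry_J by (simp_all add: isometry_def)

lemma YX: "Y \<cdot> X = 1"
  and X_J: "X \<cdot> J x = 0"
  and Y_J: "Y \<cdot> J x = 0"
  using XY J_X J_Y by (simp_all add: cdot_commute)

lemmas frame_simps = XX YY XY YX J_X J_Y X_J Y_J J_cdot_J

lemma coord_J: "coord J (J x) = x"
  by (simp add: coord_def vec_eq_iff J_cdot_J cdot_axis)

lemma coord_X: "coord J X = 0"
  and coord_Y: "coord J Y = 0"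
  by (simp_all add: coord_def vec_eq_iff frame_simps)

lemmas frame_coord_simps = coord_J coord_X coord_Y

lemma expansion: "v = J (coord J v) + (v \<cdot> Y) *s X + (v \<cdot> X) *s Y"
proof -
  obtain x a b where v: "v = J x + a *s X + b *s Y"
    using complete by blast
  then have "v \<cdot> Y = a" "v \<cdot> X = b" "coord J v = x"
    by (simp_all add: cdot_simps frame_simps coord_simps frame_coord_simps)
  then show ?thesis using v by simp
qed

lemma cdot_J: "v \<cdot> J z = coord J v \<cdot> z"
  by (subst expansion[of v]) (simp add: cdot_simps frame_simps)

lemma J_cdot: "J z \<cdot> v = z \<cdot> coord J v"
  using cdot_J cdot_commute by metis

lemma X_nonzero: "X \<noteq> 0"
  using XY by (auto simp: cdot_zero)

lemma orthogonal_eq_range: "v \<cdot> X = 0 \<Longrightarrow> v \<cdot> Y = 0 \<Longrightarrow> v \<in> range J"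
  using expansion[of v] by (metis add.right_neutral rangeI vec.scale_zero_left)

end

section \<open>Skew and diagonalizable maps\<close>

lemma skew_clinear: "C \<in> skew_maps \<Longrightarrow> clinear C"
  and skew_cdot: "C \<in> skew_maps \<Longrightarrow> C x \<cdot> y = - (x \<cdot> C y)"
  by (simp_all add: skew_maps_def)

lemma skew_swap: "C \<in> skew_maps \<Longrightarrow> C x \<cdot> y = - (C y \<cdot> x)"
  using skew_cdot[of C x y] cdot_commute[of x "C y"] by simp

lemma skew_cdot_self: "C \<in> skew_maps \<Longrightarrow> C x \<cdot> x = 0"
  using skew_swap[of C x x] by simp

text \<open>
  Spanning sets, unlike bases, are preserved by arbitrary linear images, which makes this
  form of diagonalizability easy to transport.
\<close>

lemma diagonalizable_on_iff_span_eigenvectors: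
  "diagonalizable_on V f \<longleftrightarrow> (\<exists>S. vec.span S = V \<and> (\<forall>v\<in>S. \<exists>c. f v = c *s v))"
proof
  assume "\<exists>S. vec.span S = V \<and> (\<forall>v\<in>S. \<exists>c. f v = c *s v)"
  then obtain S where S: "vec.span S = V" "\<forall>v\<in>S. \<exists>c. f v = c *s v" by blast
  obtain b where b: "b \<subseteq> S" "vec.independent b" "S \<subseteq> vec.span b"
    using vec.maximal_independent_subset by blast
  then have "vec.span b = V"
    using S(1) vec.span_mono[of b S] vec.span_minimal[of S "vec.span b"] by auto
  then show "diagonalizable_on V f"
    using b S(2) unfolding diagonalizable_on_def by blast
qed (auto simp: diagonalizable_on_def)

lemma diagonalizable_on_intertwined:
  assumes "diagonalizable_on V f" "clinear g" "\<And>v. v \<in> V \<Longrightarrow> f' (g v) = g (f v)"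
  shows "diagonalizable_on (g ` V) f'"
proof -
  obtain S where S: "vec.span S = V" "\<forall>v\<in>S. \<exists>c. f v = c *s v"
    using assms(1) unfolding diagonalizable_on_iff_span_eigenvectors by blast
  have "\<exists>c. f' (g v) = c *s g v" if "v \<in> S" for v
  proof -
    have "v \<in> V" using S(1) that vec.span_base by blast
    then show ?thesis
      using S(2) that assms(3) clinear_scale[OF assms(2)] by metis
  qed
  then show ?thesis
    unfolding diagonalizable_on_iff_span_eigenvectors
    using vec.linear_span_image[OF assms(2), of S] S(1) by (intro exI[of _ "g ` S"]) auto
qed

text \<open>
  An eigenvector for the eigenvalue zero lies in the kernel and any other eigenvector lies in the
  range. All later uses of semisimplicity go through this decomposition.
\<close>

lemma diagonalizable_kernel_plus_range:
  assumes "clinear C" "diagonalizable_on UNIV C"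
  obtains k z where "C k = 0" "y = k + C z"
proof -
  obtain S where S: "vec.span S = UNIV" "\<forall>v\<in>S. \<exists>c. C v = c *s v"
    using assms(2) unfolding diagonalizable_on_iff_span_eigenvectors by blast
  define W where "W = {k + C z |k z. C k = 0}"
  have W_eq: "W = {a + b |a b. a \<in> {k. C k = 0} \<and> b \<in> range C}"
    unfolding W_def by blast
  have "vec.subspace {k. C k = 0}"
    by (simp add: vec.subspace_def clinear_simps[OF assms(1)])
  then have "vec.subspace W"
    unfolding W_eq by (rule vec.subspace_sums[OF _ subspace_range[OF assms(1)]])
  have W_intro: "k + C z \<in> W" if "C k = 0" for k z
    using that unfolding W_def by blast
  have "v \<in> W" if v: "v \<in> S" for v
  proof -
    obtain c where c: "C v = c *s v" using S(2) v by blast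
    show ?thesis
    proof (cases "c = 0")
      case True
      then have "v + C 0 \<in> W"
        using c by (intro W_intro) simp
      then show ?thesis
        by (simp add: clinear_zero[OF assms(1)])
    next
      case False
      have "0 + C (inverse c *s v) \<in> W"
        by (intro W_intro) (rule clinear_zero[OF assms(1)])
      then show ?thesis
        using False by (simp add: clinear_scale[OF assms(1)] c vec.scale_scale)
    qed
  qed
  then have "vec.span S \<subseteq> W"
    by (intro vec.span_minimal \<open>vec.subspace W\<close>) blast
  then have "y \<in> W" using S(1) by blast
  then show ?thesis using that unfolding W_def by blast
qed

text \<open>
  For a skew map, \<open>C z\<close> is orthogonal to the kernel; if moreover \<open>C z\<close> lies in the kernel, it is
  orthogonal to the range as well, hence to everything.
\<close>

lemma skew_diagonalizable_kernel_range:
  assumes C: "C \<in> skew_maps" "diagonalizable_on UNIV C" and "C (C z) = 0"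
  shows "C z = 0"
proof (rule cdot_nondegenerate)
  fix y
  obtain k w where y: "C k = 0" "y = k + C w"
    using diagonalizable_kernel_plus_range[OF skew_clinear[OF C(1)] C(2)] by blast
  have "C z \<cdot> k = 0" "C z \<cdot> C w = 0"
    using skew_cdot[OF C(1), of z k] skew_cdot[OF C(1), of "C z" w] assms(3) y
    by (simp_all add: cdot_zero)
  then show "C z \<cdot> y = 0" by (simp add: y cdot_simps)
qed

definition semisimple_skew :: "(complex ^ 'n \<Rightarrow> complex ^ 'n) set" where
  "semisimple_skew = {C \<in> skew_maps. C \<noteq> (\<lambda>x. 0) \<and> diagonalizable_on UNIV C}"

section \<open>The double extension of a skew map\<close>

lemma nondeg_canonical_form: "nondeg_symmetric_bilinear canonical_form"
  unfolding nondeg_symmetric_bilinear_def clinear_functional_iff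
  using cdot_nondegenerate by (auto simp: cdot_simps intro: cdot_commute)

lemma sum_fun_apply: "(\<Sum>i\<in>S. f i) x = (\<Sum>i\<in>S. f i (x :: 'a) :: complex)"
  by (induction S rule: infinite_finite_induct) auto

text \<open>
  The dimension in \<^const>\<open>dup\<close> is taken in the infinite-dimensional space of all functions, where an
  infinite basis would have cardinality zero. The coordinate functions span the dual space, so the
  basis in question is finite, and it is not empty because \<open>\<alpha>\<close> is nonzero.
\<close>

lemma dup_pos:
  fixes \<alpha> :: "complex ^ 'k \<Rightarrow> complex"
  assumes "Vector_Spaces.linear (*s) (*) \<alpha>"
    and "\<And>x y z w. wedge_1_3 \<alpha> (three_form B br) x y z w = 0"
    and "\<alpha> u \<noteq> 0"
  shows "dup B br \<ge> 1"
proof -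
  interpret fs: vector_space "fun_scale :: complex \<Rightarrow> (complex ^ 'k \<Rightarrow> complex) \<Rightarrow> _"
    by (rule vector_space_fun_scale)
  define V where "V = {\<alpha>. Vector_Spaces.linear (*s) (*) \<alpha> \<and>
     (\<forall>x y z w. wedge_1_3 \<alpha> (three_form B br) x y z w = 0)}"
  define E :: "(complex ^ 'k \<Rightarrow> complex) set" where "E = range (\<lambda>i v. v $ i)"
  have "\<beta> \<in> fs.span E" if "\<beta> \<in> V" for \<beta>
  proof -
    have lin: "\<beta> (x + y) = \<beta> x + \<beta> y" "\<beta> (c *s x) = c * \<beta> x" for x y c
      using that by (auto simp: V_def clinear_functional_iff)
    have "\<beta> 0 = 0" using lin(2)[of 0 0] by simp
    then have sum: "\<beta> (\<Sum>i\<in>T. f i) = (\<Sum>i\<in>T. \<beta> (f i))" for f and T :: "'k set"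
      by (induction T rule: infinite_finite_induct) (auto simp: lin)
    have "\<beta> = (\<Sum>i\<in>UNIV. fun_scale (\<beta> (axis i 1)) (\<lambda>v. v $ i))"
    proof
      fix v :: "complex ^ 'k"
      have "\<beta> v = \<beta> (\<Sum>i\<in>UNIV. v $ i *s axis i 1)"
        by (simp add: basis_expansion)
      then show "\<beta> v = (\<Sum>i\<in>UNIV. fun_scale (\<beta> (axis i 1)) (\<lambda>v. v $ i)) v"
        by (simp add: sum lin fun_scale_def sum_fun_apply mult.commute)
    qed
    also have "\<dots> \<in> fs.span E"
      by (intro fs.span_sum fs.span_scale fs.span_base) (auto simp: E_def)
    finally show ?thesis .
  qed
  moreover obtain b where b: "b \<subseteq> V" "fs.independent b" "V \<subseteq> fs.span b" "card b = fs.dim V"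
    using fs.basis_exists by blast
  ultimately have "finite b"
    using fs.independent_span_bound[of E b] by (auto simp: E_def)
  have "\<alpha> \<in> V" "\<alpha> \<noteq> 0"
    using assms by (auto simp: V_def)
  then have "b \<noteq> {}" using b(3) by auto
  then have "card b \<ge> 1"
    using \<open>finite b\<close> by (simp add: Suc_le_eq card_gt_0_iff)
  then show ?thesis
    using b(4) by (simp add: dup_def V_def)
qed

text \<open>
  The double extension bracket of \<open>C\<close> along a frame, where \<open>v \<cdot> X\<close> is the
  coefficient of \<open>v\<close> along \<open>Y\<close>.
\<close>

definition double_ext ::
    "complex ^ 'm \<Rightarrow> (complex ^ 'n \<Rightarrow> complex ^ 'm) \<Rightarrow> (complex ^ 'n \<Rightarrow> complex ^ 'n) \<Rightarrow> (complex ^ 'm) bracket"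
  where
  "double_ext X J C v w =
     (v \<cdot> X) *s J (C (coord J w)) - (w \<cdot> X) *s J (C (coord J v))
       + (C (coord J v) \<cdot> coord J w) *s X"

locale double_extension = frame X Y J
  for X Y :: "complex ^ 'm" and J :: "complex ^ 'n \<Rightarrow> complex ^ 'm" +
  fixes C :: "complex ^ 'n \<Rightarrow> complex ^ 'n"
  assumes skew: "C \<in> skew_maps"
begin

abbreviation bracket :: "(complex ^ 'm) bracket" where
  "bracket \<equiv> double_ext X J C"

lemmas C_simps = clinear_simps[OF skew_clinear[OF skew]]
lemmas J_simps = clinear_simps[OF clinear_J]

lemma bracket_Y_J: "bracket Y (J x) = J (C x)"
  by (simp add: double_ext_def frame_simps frame_coord_simps C_simps J_simps cdot_simps)

lemma bracket_J_J: "bracket (J x) (J y) = (C x \<cdot> y) *s X"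
  by (simp add: double_ext_def frame_simps frame_coord_simps)

lemma bracket_cdot_X: "bracket v w \<cdot> X = 0"
  by (simp add: double_ext_def frame_simps cdot_simps)

lemma coord_bracket:
  "coord J (bracket v w) = (v \<cdot> X) *s C (coord J w) - (w \<cdot> X) *s C (coord J v)"
  by (simp add: double_ext_def coord_simps frame_coord_simps)

text \<open>
  The three-form of the double extension is the wedge product of the linear form \<open>v \<mapsto> v \<cdot> X\<close> with the
  two-form given by \<open>C\<close>. Invariance and \<open>dup \<ge> 1\<close> both follow from this.
\<close>

lemma bracket_cdot:
  "bracket x y \<cdot> z = (x \<cdot> X) * (C (coord J y) \<cdot> coord J z)
      - (y \<cdot> X) * (C (coord J x) \<cdot> coord J z) + (z \<cdot> X) * (C (coord J x) \<cdot> coord J y)"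
  by (simp add: double_ext_def cdot_simps J_cdot cdot_commute[of X z])

lemma bracket_jacobi:
  "bracket x (bracket y z) + bracket y (bracket z x) + bracket z (bracket x y) = 0"
proof -
  let ?b = "\<lambda>u v. C (coord J u) \<cdot> C (coord J v)"
  let ?D = "\<lambda>u. J (C (C (coord J u)))"
  \<comment> \<open>The coefficient of \<open>X\<close> in an inner bracket is lost, since \<open>X\<close> is central. The remaining terms
  cancel cyclically because \<open>C u \<cdot> C w\<close> is symmetric in \<open>u\<close> and \<open>w\<close>.\<close>
  have nested: "bracket u (bracket v w) = ((u \<cdot> X) * (v \<cdot> X)) *s ?D w - ((u \<cdot> X) * (w \<cdot> X)) *s ?D v
      + ((v \<cdot> X) * ?b u w - (w \<cdot> X) * ?b u v) *s X" for u v w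
    unfolding double_ext_def[of X J C u "bracket v w"] coord_bracket bracket_cdot_X
    by (simp add: C_simps J_simps cdot_simps vec_eq_iff algebra_simps)
  have "?b y x = ?b x y" "?b z x = ?b x z" "?b z y = ?b y z"
    by (simp_all add: cdot_commute)
  then show ?thesis
    unfolding nested by (simp add: vec_eq_iff algebra_simps)
qed

lemma bracket_lie: "lie_bracket bracket"
  unfolding lie_bracket_def
proof (intro conjI allI)
  show "clinear (bracket x)" "clinear (\<lambda>x. bracket x y)" for x y
    by (auto simp: clinear_iff double_ext_def coord_simps C_simps J_simps cdot_simps
        vec_eq_iff algebra_simps)
  show "bracket x x = 0" for x
    by (simp add: double_ext_def skew_cdot_self[OF skew])
qed (rule bracket_jacobi)

lemma bracket_quadratic: "quadratic_lie_algebra canonical_form bracket"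
proof -
  have "bracket x y \<cdot> z = x \<cdot> bracket y z" for x y z
  proof -
    let ?b = "\<lambda>u v. C (coord J u) \<cdot> coord J v"
    have "?b z x = - ?b x z" "?b y x = - ?b x y"
      using skew_swap[OF skew] by blast+
    then show ?thesis
      unfolding cdot_commute[of x "bracket y z"] bracket_cdot by (simp add: algebra_simps)
  qed
  then show ?thesis
    using bracket_lie nondeg_canonical_form by (auto simp: quadratic_lie_algebra_def)
qed

text \<open>
  The linear factor \<open>v \<mapsto> v \<cdot> X\<close> of the three-form has zero wedge product with it, and is nonzero at \<open>Y\<close>.
\<close>

lemma bracket_dup: "dup canonical_form bracket \<ge> 1"
proof (rule dup_pos[where \<alpha> = "\<lambda>v. v \<cdot> X" and u = Y])
  fix x y z w
  let ?b = "\<lambda>u v. C (coord J u) \<cdot> coord J v"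
  show "wedge_1_3 (\<lambda>v. v \<cdot> X) (three_form canonical_form bracket) x y z w = 0"
    unfolding wedge_1_3_def three_form_def bracket_cdot by (simp add: algebra_simps)
qed (simp_all add: clinear_functional_iff cdot_simps YX)

text \<open>
  Brackets are orthogonal to \<open>X\<close>, brackets of such vectors are multiples of \<open>X\<close>, and \<open>X\<close> is central.
\<close>

lemma bracket_solvable: "solvable bracket"
proof -
  define D where "D = derived_series bracket"
  have D_Suc: "D (Suc k) \<subseteq> W"
    if "vec.subspace W" "\<And>x y. x \<in> D k \<Longrightarrow> y \<in> D k \<Longrightarrow> bracket x y \<in> W" for k W
    unfolding D_def derived_series.simps using that
    by (intro vec.span_minimal) (auto simp: D_def)
  have D1: "v \<cdot> X = 0" if "v \<in> D 1" for v
  proof -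
    have "D (Suc 0) \<subseteq> {v. v \<cdot> X = 0}"
      by (rule D_Suc) (simp_all add: vec.subspace_def cdot_simps bracket_cdot_X)
    then show ?thesis using that by auto
  qed
  have "D (Suc 1) \<subseteq> vec.span {X}"
  proof (rule D_Suc)
    fix v w assume "v \<in> D 1" "w \<in> D 1"
    then have "bracket v w = (C (coord J v) \<cdot> coord J w) *s X"
      by (simp add: double_ext_def D1 del: One_nat_def)
    then show "bracket v w \<in> vec.span {X}"
      by (simp add: vec.span_base vec.span_scale)
  qed simp
  then have D2: "\<exists>c. v = c *s X" if "v \<in> D (Suc 1)" for v
    using that by (auto simp: vec.span_singleton)
  have "D (Suc (Suc 1)) \<subseteq> {0}"
  proof (rule D_Suc)
    fix v w assume "v \<in> D (Suc 1)" "w \<in> D (Suc 1)"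
    then obtain a b where "v = a *s X" "w = b *s X"
      using D2 by blast
    then show "bracket v w \<in> {0}"
      by (simp add: double_ext_def coord_simps frame_coord_simps C_simps cdot_simps frame_simps)
  qed (rule vec.subspace_single_0)
  moreover have "0 \<in> D (Suc (Suc 1))"
    by (simp add: D_def vec.span_zero)
  ultimately have "D (Suc (Suc 1)) = {0}" by blast
  then show ?thesis unfolding solvable_def D_def by blast
qed

lemma bracket_decomposition: "double_extension_decomposition canonical_form bracket X Y (range J)"
  unfolding double_extension_decomposition_def
proof (intro conjI ballI allI)
  show "vec.span {X, Y} \<inter> range J = {0}"
  proof (intro equalityI subsetI)
    fix v assume "v \<in> vec.span {X, Y} \<inter> range J"
    then obtain a b x where v: "v = a *s X + b *s Y" "v = J x"
      by (auto simp: vec.span_insert algebra_simps)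
    have "v \<cdot> X = 0" "v \<cdot> Y = 0" unfolding v(2) by (simp_all add: J_X J_Y)
    then have "a = 0" "b = 0" unfolding v(1) by (simp_all add: cdot_simps frame_simps)
    then show "v \<in> {0}" using v by simp
  next
    fix v :: "complex ^ 'm" assume "v \<in> {0}"
    moreover have "0 = J 0" by (simp add: J_simps)
    ultimately show "v \<in> vec.span {X, Y} \<inter> range J"
      using vec.span_zero by auto
  qed
  show "\<exists>u\<in>vec.span {X, Y}. \<exists>x\<in>range J. v = u + x" for v
  proof (intro bexI)
    show "v = ((v \<cdot> Y) *s X + (v \<cdot> X) *s Y) + J (coord J v)"
      using expansion[of v] by (simp add: ac_simps)
  qed (auto intro: vec.span_add vec.span_scale vec.span_base)
qed (auto simp: frame_simps bracket_Y_J skew_cdot[OF skew] subspace_range[OF clinear_J]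
      double_ext_def coord_simps frame_coord_simps C_simps J_simps cdot_simps)

lemma bracket_nonabelian: "C \<noteq> (\<lambda>x. 0) \<Longrightarrow> \<not> abelian bracket"
  unfolding abelian_def
  using bracket_Y_J coord_J by (metis coord_simps(3) ext)

lemma bracket_mem_diag_structures:
  assumes "C \<noteq> (\<lambda>x. 0)" "diagonalizable_on UNIV C"
  shows "bracket \<in> diag_structures"
  unfolding diag_structures_def diagonalizable_singular_def singular_def
  using assms bracket_quadratic bracket_nonabelian bracket_dup bracket_solvable
    bracket_decomposition diagonalizable_on_intertwined[OF assms(2) clinear_J, of "bracket Y"]
  by (auto simp: bracket_Y_J)

end

section \<open>Presentations of diagonalizable structures\<close>

lemma (in frame) decomposition_eq_range:
  assumes "double_extension_decomposition canonical_form br X Y q"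
  shows "q = range J"
proof (intro equalityI subsetI)
  fix x assume "x \<in> q"
  then show "x \<in> range J"
    using assms by (intro orthogonal_eq_range) (auto simp: double_extension_decomposition_def)
next
  fix v assume "v \<in> range J"
  then have v: "v \<cdot> X = 0" "v \<cdot> Y = 0" by (auto simp: frame_simps)
  obtain u x where ux: "u \<in> vec.span {X, Y}" "x \<in> q" "v = u + x"
    using assms unfolding double_extension_decomposition_def by blast
  then obtain a b where u: "u = a *s X + b *s Y"
    by (auto simp: vec.span_insert algebra_simps)
  have "x \<cdot> X = 0" "x \<cdot> Y = 0"
    using assms ux(2) by (auto simp: double_extension_decomposition_def)
  then have "b = 0" "a = 0"
    using v unfolding ux(3) u by (simp_all add: cdot_simps frame_simps)
  then show "v \<in> q" using ux u by simp
qed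

lemma double_ext_zero: "double_ext X J (\<lambda>x. 0) v w = 0" if "clinear J"
  by (simp add: double_ext_def clinear_zero[OF that] cdot_zero)

text \<open>
  The correspondence between brackets on the large space and skew maps on the small one. It is a
  relation because neither the frame nor the skew map is determined by the bracket.
\<close>

definition presents :: "(complex ^ 'm) bracket \<Rightarrow> (complex ^ 'n \<Rightarrow> complex ^ 'n) \<Rightarrow> bool" where
  "presents br C \<longleftrightarrow>
     C \<in> semisimple_skew \<and>
     (\<exists>X Y (J :: complex ^ 'n \<Rightarrow> complex ^ 'm). frame X Y J \<and> br = double_ext X J C)"

lemma presentsE:
  assumes "presents br C"
  obtains X Y J where "double_extension X Y J C" "br = double_ext X J C"
    "C \<noteq> (\<lambda>x. 0)" "diagonalizable_on UNIV C"
  using assms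
  by (auto simp: presents_def semisimple_skew_def double_extension_def double_extension_axioms_def)

lemma presents_diag_structures: "presents br C \<Longrightarrow> br \<in> diag_structures"
  by (elim presentsE) (simp add: double_extension.bracket_mem_diag_structures)

text \<open>
  The complement of a hyperbolic pair is determined by the pair, so it is the range of \<open>J\<close> for any
  frame on that pair; the skew map is then \<open>ad Y\<close> read through \<open>J\<close>.
\<close>

lemma diag_structures_presents:
  fixes br :: "(complex ^ 'm) bracket"
  assumes card: "CARD('m) = CARD('n) + 2" and br: "br \<in> diag_structures"
  shows "\<exists>C :: complex ^ 'n \<Rightarrow> complex ^ 'n. presents br C"
proof -
  obtain X Y q where dec: "double_extension_decomposition canonical_form br X Y q"
    and diag: "diagonalizable_on q (br Y)"
    and nonabelian: "\<not> abelian br" and lie: "lie_bracket br"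
    using br by (auto simp: diag_structures_def diagonalizable_singular_def singular_def
        quadratic_lie_algebra_def)
  have "X \<cdot> X = 0" "Y \<cdot> Y = 0" "X \<cdot> Y = 1"
    using dec by (simp_all add: double_extension_decomposition_def)
  then obtain J :: "complex ^ 'n \<Rightarrow> complex ^ 'm" where frame: "frame X Y J"
    using hyperbolic_pair_frame[OF card] by blast
  interpret frame X Y J by (rule frame)
  have q: "q = range J" by (rule decomposition_eq_range[OF dec])
  define C where "C x = coord J (br Y (J x))" for x
  have "br Y (J x) \<in> range J" for x
    using dec unfolding q double_extension_decomposition_def by blast
  then have JC: "J (C x) = br Y (J x)" for x
    by (metis C_def coord_J imageE)
  have clinear_br: "clinear (br Y)"
    using lie by (simp add: lie_bracket_def)
  have "clinear C"
    unfolding C_def using clinear_compose[OF clinear_coord clinear_compose[OF clinear_br clinear_J]]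
    by (simp add: comp_def)
  moreover have "C x \<cdot> y = - (x \<cdot> C y)" for x y
  proof -
    have "J (C x) \<cdot> J y = - (J x \<cdot> J (C y))"
      using dec unfolding JC q double_extension_decomposition_def by blast
    then show ?thesis by (simp add: J_cdot_J)
  qed
  ultimately have "C \<in> skew_maps" by (simp add: skew_maps_def)
  have br_eq: "br = double_ext X J C"
  proof (intro ext)
    fix v w
    have "br (J (coord J v) + (v \<cdot> Y) *s X + (v \<cdot> X) *s Y) (J (coord J w) + (w \<cdot> Y) *s X + (w \<cdot> X) *s Y)
        = (v \<cdot> X) *s br Y (J (coord J w)) - (w \<cdot> X) *s br Y (J (coord J v))
          + (br Y (J (coord J v)) \<cdot> J (coord J w)) *s X"
      using dec unfolding q double_extension_decomposition_def by blast
    then show "br v w = double_ext X J C v w"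
      unfolding expansion[symmetric] JC[symmetric] double_ext_def J_cdot_J .
  qed
  have "C \<noteq> (\<lambda>x. 0)"
    using nonabelian double_ext_zero[OF clinear_J] by (auto simp: br_eq abelian_def)
  moreover have "diagonalizable_on (coord J ` q) C"
    using diag clinear_coord by (rule diagonalizable_on_intertwined) (auto simp: q C_def coord_J)
  moreover have "coord J ` q = UNIV"
    by (simp add: q image_image coord_J)
  ultimately show ?thesis
    using \<open>C \<in> skew_maps\<close> frame br_eq by (auto simp: presents_def semisimple_skew_def)
qed

text \<open>
  For two coordinate vectors \<open>e\<close> and \<open>f\<close>, the isotropic vectors \<open>e \<plusminus> \<i> f\<close> are a hyperbolic pair up to
  scaling.
\<close>

lemma frame_exists:
  assumes "CARD('m) = CARD('n) + 2"
  shows "\<exists>X Y (J :: complex ^ 'n \<Rightarrow> complex ^ 'm). frame X Y J"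
proof -
  have "CARD('m) \<ge> 2" using assms by simp
  then obtain i j :: 'm where "i \<noteq> j"
    by (metis card_le_Suc0_iff_eq finite_class.finite_UNIV UNIV_I not_less_eq_eq numeral_2_eq_2)
  define X Y :: "complex ^ 'm"
    where "X = axis i 1 + \<i> *s axis j 1" and "Y = (1/2) *s (axis i 1 - \<i> *s axis j 1)"
  have "axis i 1 \<cdot> (axis i 1) = 1" "axis j 1 \<cdot> (axis j 1) = 1"
    "axis i 1 \<cdot> (axis j 1) = 0" "axis j 1 \<cdot> (axis i 1) = 0"
    using \<open>i \<noteq> j\<close> by (simp_all add: cdot_axis) (simp_all add: axis_def)
  then have "X \<cdot> X = 0" "Y \<cdot> Y = 0" "X \<cdot> Y = 1"
    by (simp_all add: X_def Y_def cdot_simps algebra_simps)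
  then show ?thesis using hyperbolic_pair_frame[OF assms] by blast
qed

lemma presents_exists:
  fixes C :: "complex ^ 'n \<Rightarrow> complex ^ 'n"
  assumes "CARD('m) = CARD('n) + 2" "C \<in> semisimple_skew"
  shows "\<exists>br :: (complex ^ 'm) bracket. presents br C"
  using frame_exists[OF assms(1)] assms(2) by (auto simp: presents_def)

section \<open>Isometric isomorphism and conjugacy\<close>

definition conjugate_up_to_scalar ::
    "(complex ^ 'n \<Rightarrow> complex ^ 'n) \<Rightarrow> (complex ^ 'n \<Rightarrow> complex ^ 'n) \<Rightarrow> bool" where
  "conjugate_up_to_scalar C C' \<longleftrightarrow>
     (\<exists>U s. isometry U \<and> s \<noteq> 0 \<and> C' = (\<lambda>x. s *s U (C (inv U x))))"

lemma frame_image: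
  fixes T :: "complex ^ 'm \<Rightarrow> complex ^ 'm"
  assumes "frame X Y J" and T: "isometry T"
  shows "frame (T X) (T Y) (T \<circ> J)"
proof -
  interpret frame X Y J by fact
  show ?thesis
  proof
    fix v
    have "v = T (inv T v)"
      using isometry_bij[OF T] by (simp add: bij_is_surj surj_f_inv_f)
    also obtain x a b where "inv T v = J x + a *s X + b *s Y"
      using complete by blast
    finally show "\<exists>x a b. v = (T \<circ> J) x + a *s T X + b *s T Y"
      by (auto simp: clinear_simps[OF isometry_clinear[OF T]])
  qed (auto simp: isometry_cdot[OF T] frame_simps intro: isometry_compose T isometry_J)
qed

lemma coord_image: "isometry T \<Longrightarrow> coord (T \<circ> J) (T v) = coord J v"
  by (simp add: coord_def isometry_cdot)

lemma double_ext_image: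
  "isometry T \<Longrightarrow> double_ext (T X) (T \<circ> J) C (T v) (T w) = T (double_ext X J C v w)"
  by (simp add: double_ext_def coord_image isometry_cdot clinear_simps[OF isometry_clinear])

lemma i_isomorphic_canonical_iff:
  fixes br br' :: "(complex ^ 'm) bracket"
  shows "i_isomorphic canonical_form br canonical_form br' \<longleftrightarrow>
     (\<exists>T. isometry T \<and> (\<forall>x y. T (br x y) = br' (T x) (T y)))"
  unfolding i_isomorphic_def using isometry_bij by (auto simp: isometry_def)

text \<open>
  Witt's theorem for frames: the map that matches two frames is an isometry, and it carries the double
  extension along one to that along the other.
\<close>

lemma i_isomorphic_double_ext_frames:
  fixes X X' :: "complex ^ 'm" and J J' :: "complex ^ 'n \<Rightarrow> complex ^ 'm"
  assumes "frame X Y J" "frame X' Y' J'"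
  shows "i_isomorphic canonical_form (double_ext X J C) canonical_form (double_ext X' J' C)"
proof -
  interpret F: frame X Y J by fact
  interpret F': frame X' Y' J' by fact
  define T where "T v = J' (coord J v) + (v \<cdot> Y) *s X' + (v \<cdot> X) *s Y'" for v
  have "clinear T"
    by (simp add: clinear_iff T_def coord_simps F'.clinear_J[THEN clinear_add]
        F'.clinear_J[THEN clinear_scale] cdot_simps vec_eq_iff algebra_simps)
  moreover have "T v \<cdot> T w = v \<cdot> w" for v w
  proof -
    have "v \<cdot> w = (J (coord J v) + (v \<cdot> Y) *s X + (v \<cdot> X) *s Y) \<cdot>
        (J (coord J w) + (w \<cdot> Y) *s X + (w \<cdot> X) *s Y)"
      by (simp flip: F.expansion)
    then show ?thesis
      by (simp add: T_def cdot_simps F.frame_simps F'.frame_simps)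
  qed
  ultimately have T: "isometry T" by (simp add: isometry_def)
  have "T X = X'" "T \<circ> J = J'"
    by (simp_all add: fun_eq_iff T_def F.frame_simps F.frame_coord_simps
        clinear_zero[OF F'.clinear_J])
  then show ?thesis
    using T double_ext_image[OF T, of X J C] by (auto simp: i_isomorphic_canonical_iff)
qed

text \<open>
  Replacing \<open>C\<close> by a scalar multiple of an orthogonal conjugate only amounts to another frame for
  the same bracket: the scalar is absorbed by the hyperbolic pair and the conjugation by \<open>J\<close>.
\<close>

lemma frame_conjugate:
  fixes J :: "complex ^ 'n \<Rightarrow> complex ^ 'm" and U :: "complex ^ 'n \<Rightarrow> complex ^ 'n"
  assumes "frame X Y J" and U: "isometry U" and s: "s \<noteq> 0" and C: "clinear C"
  shows "frame (inverse s *s X) (s *s Y) (J \<circ> inv U)"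
    and "double_ext (inverse s *s X) (J \<circ> inv U) (\<lambda>x. s *s U (C (inv U x))) = double_ext X J C"
proof -
  interpret frame X Y J by fact
  have UU: "inv U (U x) = x" "U (inv U x) = x" for x
    using isometry_bij[OF U] by (simp_all add: bij_is_inj bij_is_surj surj_f_inv_f)
  show "frame (inverse s *s X) (s *s Y) (J \<circ> inv U)"
  proof
    fix v
    obtain x a b where "v = J x + a *s X + b *s Y"
      using complete by blast
    then have "v = (J \<circ> inv U) (U x) + (a * s) *s (inverse s *s X) + (b * inverse s) *s (s *s Y)"
      using s by (simp add: UU vec_eq_iff field_simps)
    then show "\<exists>x a b. v = (J \<circ> inv U) x + a *s (inverse s *s X) + b *s (s *s Y)"
      by blast
  qed (use s in \<open>auto simp: cdot_simps frame_simps intro: isometry_compose isometry_J isometry_inv U\<close>)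
  have coord_eq: "coord (J \<circ> inv U) v = U (coord J v)" for v
  proof (rule cdot_eqI)
    fix z
    interpret F: frame "inverse s *s X" "s *s Y" "J \<circ> inv U" by fact
    have "coord (J \<circ> inv U) v \<cdot> z = v \<cdot> J (inv U z)"
      using F.cdot_J[of v z] by simp
    also have "\<dots> = U (coord J v) \<cdot> U (inv U z)"
      by (simp add: cdot_J isometry_cdot[OF U])
    finally show "coord (J \<circ> inv U) v \<cdot> z = U (coord J v) \<cdot> z"
      by (simp add: UU)
  qed
  have cancel: "inverse s * c * s = c" "s * c * inverse s = c" for c
    using s by (simp_all add: field_simps)
  show "double_ext (inverse s *s X) (J \<circ> inv U) (\<lambda>x. s *s U (C (inv U x))) = double_ext X J C"
    by (intro ext)
      (simp add: double_ext_def coord_eq cancel UU cdot_simps isometry_cdot[OF U] isometry_clinear[OF isometry_inv[OF U]]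
        clinear_scale clinear_J vec.scale_scale)
qed

text \<open>
  A bracket determines its skew map up to scalar and conjugacy. For a diagonalizable nonzero map, the
  line of \<open>X\<close> is intrinsic: it consists of the central vectors that are sums of brackets, because
  kernel and range of the map meet only in zero. Hence \<open>X = s X'\<close>. Both copies of the small space are
  then complements of \<open>X\<close> in the orthogonal space of \<open>X\<close>, and projecting one onto the other along \<open>X\<close>
  is an isometry \<open>U\<close>. It intertwines the maps up to the scalar by which \<open>Y\<close> and \<open>Y'\<close> differ modulo
  the orthogonal space of \<open>X\<close>.
\<close>

lemma equal_double_ext_conjugate:
  assumes "double_extension X Y J C" "double_extension X' Y' J' C'"
    and "C \<noteq> (\<lambda>x. 0)" "diagonalizable_on UNIV C'"
    and eq: "double_ext X J C = double_ext X' J' C'"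
  shows "conjugate_up_to_scalar C C'"
proof -
  interpret F: double_extension X Y J C by fact
  interpret F': double_extension X' Y' J' C' by fact
  obtain x where "C x \<noteq> 0" using assms(3) by auto
  then obtain y where "C x \<cdot> y \<noteq> 0" using cdot_nondegenerate by blast
  \<comment> \<open>\<open>X\<close> is a bracket and central; in the second frame this puts its component in the small space into
  the range and the kernel of \<open>C'\<close>.\<close>
  then have "X = F.bracket (J x) (J (inverse (C x \<cdot> y) *s y))"
    by (simp add: F.bracket_J_J cdot_simps)
  then obtain v w where X: "X = F'.bracket v w" unfolding eq by blast
  define z where "z = (v \<cdot> X') *s coord J' w - (w \<cdot> X') *s coord J' v"
  have z: "coord J' X = C' z"
    by (simp add: X F'.coord_bracket z_def F'.C_simps)
  have XX': "X \<cdot> X' = 0"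
    by (simp add: X F'.bracket_cdot_X)
  have "F.bracket Y' X = 0"
    by (simp add: double_ext_def F.frame_simps F.frame_coord_simps F.C_simps F.J_simps cdot_zero)
  then have "coord J' (F'.bracket Y' X) = 0"
    unfolding eq by (simp add: coord_simps)
  then have "C' (C' z) = 0"
    unfolding F'.coord_bracket z XX' by (simp add: F'.frame_simps)
  then have "coord J' X = 0"
    unfolding z using F'.skew assms(4) skew_diagonalizable_kernel_range by blast
  define s where "s = X \<cdot> Y'"
  have Xs: "X = s *s X'"
    using F'.expansion[of X] by (simp add: s_def \<open>coord J' X = 0\<close> XX' F'.J_simps)
  have "s \<noteq> 0" using Xs F.X_nonzero by auto
  have X'_cdot: "v \<cdot> X' = inverse s * (v \<cdot> X)" for v
    using \<open>s \<noteq> 0\<close> by (simp add: Xs cdot_simps)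
  define U where "U = coord J' \<circ> J"
  have J_U: "J x = J' (U x) + (J x \<cdot> Y') *s X'" for x
    using F'.expansion[of "J x"] by (simp add: U_def X'_cdot F.frame_simps)
  have "U x \<cdot> U y = x \<cdot> y" for x y
  proof -
    have "x \<cdot> y = (J' (U x) + (J x \<cdot> Y') *s X') \<cdot> (J' (U y) + (J y \<cdot> Y') *s X')"
      using F.J_cdot_J[of x y] by (simp flip: J_U)
    then show ?thesis by (simp add: cdot_simps F'.frame_simps)
  qed
  then have U: "isometry U"
    using clinear_compose[OF clinear_coord F.clinear_J] by (simp add: isometry_def U_def)
  have UC: "C' (U x) = s *s U (C x)" for x
  proof -
    have "U (C x) = coord J' (F'.bracket Y (J x))"
      by (simp add: U_def F.bracket_Y_J flip: eq)
    also have "\<dots> = inverse s *s C' (U x)"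
      by (simp add: F'.coord_bracket X'_cdot F.frame_simps U_def)
    finally show ?thesis using \<open>s \<noteq> 0\<close> by (simp add: vec.scale_scale)
  qed
  have "C' = (\<lambda>x. s *s U (C (inv U x)))"
  proof
    fix x
    have "U (inv U x) = x"
      using isometry_bij[OF U] by (simp add: bij_is_surj surj_f_inv_f)
    then show "C' x = s *s U (C (inv U x))"
      using UC[of "inv U x"] by simp
  qed
  then show ?thesis
    using U \<open>s \<noteq> 0\<close> unfolding conjugate_up_to_scalar_def by blast
qed

text \<open>
  An isometric isomorphism transports the frame of the source to a second frame of the target, and
  two frames of one bracket are compared by the preceding lemma.
\<close>

lemma i_isomorphic_iff_conjugate:
  fixes br br' :: "(complex ^ 'm) bracket"
  assumes "presents br C" "presents br' C'"
  shows "i_isomorphic canonical_form br canonical_form br' \<longleftrightarrow> conjugate_up_to_scalar C C'"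
proof -
  obtain X Y J where E: "double_extension X Y J C" and br: "br = double_ext X J C"
    and C: "C \<noteq> (\<lambda>x. 0)"
    using assms(1) by (elim presentsE)
  obtain X' Y' J' where E': "double_extension X' Y' J' C'" and br': "br' = double_ext X' J' C'"
    and C': "diagonalizable_on UNIV C'"
    using assms(2) by (elim presentsE)
  have frame: "frame X Y J" "frame X' Y' J'" and skew: "C \<in> skew_maps"
    using E E' by (simp_all add: double_extension_def double_extension_axioms_def)
  show ?thesis
  proof
    assume "i_isomorphic canonical_form br canonical_form br'"
    then obtain T where T: "isometry T" "\<And>x y. T (br x y) = br' (T x) (T y)"
      by (auto simp: i_isomorphic_canonical_iff)
    have "double_ext (T X) (T \<circ> J) C = double_ext X' J' C'"
    proof (intro ext)
      fix v w
      have inv: "T (inv T u) = u" for u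
        using isometry_bij[OF T(1)] by (simp add: bij_is_surj surj_f_inv_f)
      show "double_ext (T X) (T \<circ> J) C v w = double_ext X' J' C' v w"
        using double_ext_image[OF T(1), of X J C "inv T v" "inv T w"] T(2)[of "inv T v" "inv T w"]
        by (simp add: inv br br')
    qed
    moreover have "double_extension (T X) (T Y) (T \<circ> J) C"
      using frame_image[OF frame(1) T(1)] skew
      by (simp add: double_extension_def double_extension_axioms_def)
    ultimately show "conjugate_up_to_scalar C C'"
      using equal_double_ext_conjugate E' C C' by blast
  next
    assume "conjugate_up_to_scalar C C'"
    then obtain U s where "isometry U" "s \<noteq> 0" and eq: "C' = (\<lambda>x. s *s U (C (inv U x)))"
      unfolding conjugate_up_to_scalar_def by blast
    note conj = frame_conjugate[OF frame(1) this(1,2) skew_clinear[OF skew]]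
    show "i_isomorphic canonical_form br canonical_form br'"
      using i_isomorphic_double_ext_frames[OF conj(1) frame(2), of C'] conj(2)
      by (simp add: br br' eq)
  qed
qed

section \<open>Reduced structures\<close>

text \<open>
  The center is spanned by \<open>X\<close> and the image of the kernel of \<open>C\<close>. The kernel of a diagonalizable skew
  map is orthogonal to the range and complements it, so the form stays non-degenerate on the kernel;
  the center is therefore totally isotropic exactly when the kernel is zero.
\<close>

lemma presents_reduced_iff:
  assumes "presents br C"
  shows "reduced canonical_form br \<longleftrightarrow> bij C"
proof -
  obtain X Y J where E: "double_extension X Y J C" and br: "br = double_ext X J C"
    and C: "C \<noteq> (\<lambda>x. 0)" "diagonalizable_on UNIV C"
    using assms by (elim presentsE)
  interpret double_extension X Y J C by (rule E)
  show ?thesis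
  proof
    assume red: "reduced canonical_form br"
    have center: "J k \<in> center br" if "C k = 0" for k
      using that by (simp add: center_def br double_ext_def frame_simps frame_coord_simps
          J_simps cdot_zero)
    have "k = 0" if k: "C k = 0" for k
    proof (rule cdot_nondegenerate)
      fix y
      obtain k' z where y: "C k' = 0" "y = k' + C z"
        using diagonalizable_kernel_plus_range[OF skew_clinear[OF skew] C(2)] by blast
      have "k \<cdot> k' = 0"
        using red center[OF k] center[OF y(1)] J_cdot_J[of k k'] by (auto simp: reduced_def)
      moreover have "k \<cdot> C z = 0"
        using skew_cdot[OF skew, of k z] k by (simp add: cdot_zero)
      ultimately show "k \<cdot> y = 0" by (simp add: y cdot_simps)
    qed
    then have "inj C"
      using C_simps(5) by (intro injI) (metis eq_iff_diff_eq_0)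
    then show "bij C"
      using vec.linear_inj_imp_surj[OF skew_clinear[OF skew]] by (simp add: bij_def)
  next
    assume "bij C"
    have "\<exists>c. v = c *s X" if v: "v \<in> center br" for v
    proof -
      have "coord J (bracket v Y) = 0"
        using v by (simp add: center_def br coord_simps)
      then have "C (coord J v) = C 0"
        by (simp add: coord_bracket frame_simps frame_coord_simps C_simps)
      then have P: "coord J v = 0"
        using \<open>bij C\<close> by (simp add: bij_is_inj inj_eq)
      obtain z where "C z \<noteq> 0" using C(1) by auto
      moreover have "coord J (bracket v (J z)) = 0"
        using v by (simp add: center_def br coord_simps)
      ultimately have "v \<cdot> X = 0"
        by (simp add: coord_bracket frame_simps frame_coord_simps P C_simps)
      then have "v = (v \<cdot> Y) *s X"
        using expansion[of v] by (simp add: P J_simps)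
      then show ?thesis by blast
    qed
    then have "v \<cdot> w = 0" if "v \<in> center br" "w \<in> center br" for v w
      using that by (metis XX cdot_scale_left cdot_scale_right mult_zero_right)
    then show "reduced canonical_form br"
      using bracket_quadratic X_nonzero by (auto simp: reduced_def br)
  qed
qed

section \<open>Orbits of lines\<close>

lemma map_line_scale:
  assumes "s \<noteq> 0"
  shows "map_line (\<lambda>x. s *s C x) = map_line C"
proof (intro equalityI subsetI)
  fix f assume "f \<in> map_line (\<lambda>x. s *s C x)"
  then obtain c where "f = (\<lambda>x. (c * s) *s C x)"
    by (auto simp: map_line_def vec.scale_scale)
  then show "f \<in> map_line C" by (auto simp: map_line_def)
next
  fix f assume "f \<in> map_line C"
  then obtain c where "f = (\<lambda>x. c *s C x)" by (auto simp: map_line_def)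
  also have "\<dots> = (\<lambda>x. (c * inverse s) *s (s *s C x))"
    using assms by (simp add: fun_eq_iff vec_eq_iff field_simps)
  finally show "f \<in> map_line (\<lambda>x. s *s C x)"
    unfolding map_line_def by blast
qed

lemma mem_map_line: "C \<in> map_line C"
  unfolding map_line_def by (rule image_eqI[of _ _ 1]) simp_all

lemma map_line_eq_imp_scale:
  assumes "map_line C' = map_line C" "C' \<noteq> (\<lambda>x. 0)"
  obtains s where "s \<noteq> 0" "C' = (\<lambda>x. s *s C x)"
proof -
  have "C' \<in> map_line C" using assms(1) mem_map_line by blast
  then obtain s where s: "C' = (\<lambda>x. s *s C x)" by (auto simp: map_line_def)
  with assms(2) have "s \<noteq> 0" by auto
  then show ?thesis using that s by blast
qed

lemma line_conj_map_line:
  assumes "isometry U"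
  shows "line_conj U (map_line C) = map_line (\<lambda>x. U (C (inv U x)))"
  using clinear_scale[OF isometry_clinear[OF assms]]
  by (simp add: line_conj_def map_line_def image_image comp_def)

lemma line_conj_line_conj:
  assumes "isometry U" "isometry V"
  shows "line_conj V (line_conj U L) = line_conj (V \<circ> U) L"
proof -
  have "inv (V \<circ> U) = inv U \<circ> inv V"
    using assms isometry_bij o_inv_distrib by blast
  then show ?thesis by (simp add: line_conj_def image_image comp_assoc)
qed

lemma line_orbit_eq_image: "line_orbit L = (\<lambda>U. line_conj U L) ` Collect isometry"
  by (auto simp: line_orbit_def orthogonal_grp_eq)

lemma line_orbit_line_conj:
  fixes U :: "complex ^ 'k \<Rightarrow> complex ^ 'k"
  assumes U: "isometry U"
  shows "line_orbit (line_conj U L) = line_orbit L"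
proof
  show "line_orbit (line_conj U L) \<subseteq> line_orbit L"
    unfolding line_orbit_eq_image
    using line_conj_line_conj[OF U] isometry_compose[OF _ U] by fastforce
  have "line_conj V L \<in> line_orbit (line_conj U L)" if V: "isometry V" for V
  proof -
    have "V \<circ> inv U \<circ> U = V"
      using isometry_bij[OF U] by (simp add: comp_assoc bij_is_inj)
    then have "line_conj V L = line_conj (V \<circ> inv U) (line_conj U L)"
      using line_conj_line_conj[OF U isometry_compose[OF V isometry_inv[OF U]]] by simp
    then show ?thesis
      unfolding line_orbit_eq_image
      by (intro image_eqI[where x = "V \<circ> inv U"])
        (simp_all add: isometry_compose V isometry_inv U)
  qed
  then show "line_orbit L \<subseteq> line_orbit (line_conj U L)"
    unfolding line_orbit_eq_image[of L] by blast
qed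

lemma line_orbit_eq_iff_conjugate:
  assumes "C' \<noteq> (\<lambda>x. 0)"
  shows "line_orbit (map_line C) = line_orbit (map_line C') \<longleftrightarrow> conjugate_up_to_scalar C C'"
proof
  assume eq: "line_orbit (map_line C) = line_orbit (map_line C')"
  have id: "isometry (\<lambda>x. x)" by (simp add: isometry_def clinear_iff)
  have "line_conj (\<lambda>x. x) (map_line C') = map_line C'"
    using line_conj_map_line[OF id, of C'] by simp
  then have "map_line C' \<in> line_orbit (map_line C)"
    unfolding eq unfolding line_orbit_eq_image using id
    by (intro image_eqI[where x = "\<lambda>x. x"]) simp_all
  then obtain U where U: "isometry U" and "map_line C' = line_conj U (map_line C)"
    unfolding line_orbit_eq_image by blast
  then have "map_line C' = map_line (\<lambda>x. U (C (inv U x)))"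
    by (simp add: line_conj_map_line)
  then obtain s where "s \<noteq> 0" "C' = (\<lambda>x. s *s U (C (inv U x)))"
    using assms by (rule map_line_eq_imp_scale)
  then show "conjugate_up_to_scalar C C'"
    using U unfolding conjugate_up_to_scalar_def by blast
next
  assume "conjugate_up_to_scalar C C'"
  then obtain U s where U: "isometry U" and "s \<noteq> 0" "C' = (\<lambda>x. s *s U (C (inv U x)))"
    unfolding conjugate_up_to_scalar_def by blast
  then have "map_line C' = line_conj U (map_line C)"
    by (simp add: map_line_scale line_conj_map_line)
  then show "line_orbit (map_line C) = line_orbit (map_line C')"
    by (simp add: line_orbit_line_conj[OF U])
qed

text \<open>
  The line and the diagonalizable map may be given by different generators; the diagonalizable one
  is a multiple of a skew map and hence itself skew.
\<close>

lemma semisimple_line_iff: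
  "(L \<in> proj_skew \<and> (\<exists>C. L = map_line C \<and> C \<noteq> (\<lambda>x. 0) \<and> diagonalizable_on UNIV C \<and> P C)) \<longleftrightarrow>
     (\<exists>C\<in>semisimple_skew. L = map_line C \<and> P C)"
proof
  assume "L \<in> proj_skew \<and> (\<exists>C. L = map_line C \<and> C \<noteq> (\<lambda>x. 0) \<and> diagonalizable_on UNIV C \<and> P C)"
  then obtain C C1 where C: "L = map_line C" "C \<noteq> (\<lambda>x. 0)" "diagonalizable_on UNIV C" "P C"
    and C1: "L = map_line C1" "C1 \<in> skew_maps"
    by (auto simp: proj_skew_def)
  then obtain s where s: "C = (\<lambda>x. s *s C1 x)"
    using map_line_eq_imp_scale[of C C1] by metis
  have "C \<in> skew_maps"
    using C1(2) unfolding s skew_maps_def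
    by (auto simp: clinear_iff cdot_simps vec_eq_iff algebra_simps)
  then show "\<exists>C\<in>semisimple_skew. L = map_line C \<and> P C"
    using C by (auto simp: semisimple_skew_def)
qed (auto simp: semisimple_skew_def proj_skew_def)

lemma semisimple_orbits_eq:
  "semisimple_orbits = (\<lambda>C. line_orbit (map_line C)) ` semisimple_skew"
proof -
  have "semisimple_orbits = {line_orbit L | L. \<exists>C\<in>semisimple_skew. L = map_line C}"
    unfolding semisimple_orbits_def
    by (simp add: semisimple_line_iff[where P = "\<lambda>C. True", simplified])
  then show ?thesis by auto
qed

lemma semisimple_invertible_orbits_eq:
  "semisimple_invertible_orbits =
     (\<lambda>C. line_orbit (map_line C)) ` {C \<in> semisimple_skew. bij C}"
proof -
  have "semisimple_invertible_orbits = {line_orbit L | L. \<exists>C\<in>semisimple_skew. L = map_line C \<and> bij C}"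
    unfolding semisimple_invertible_orbits_def
    by (simp add: semisimple_line_iff[where P = bij])
  then show ?thesis by auto
qed

section \<open>The bijections\<close>

text \<open>
  The inverse bijection sends a value of the invariant \<open>F\<close> to its fibre, which is a whole class.
\<close>

lemma quotient_bij_invariant:
  assumes "\<And>a b. a \<in> D \<Longrightarrow> b \<in> D \<Longrightarrow> (a, b) \<in> r \<longleftrightarrow> F a = F b"
  shows "\<exists>f. bij_betw f (D // (r \<inter> D \<times> D)) (F ` D)"
proof -
  define fibre where "fibre y = {b \<in> D. F b = y}" for y
  have "inj_on fibre (F ` D)"
    by (auto simp: inj_on_def fibre_def)
  moreover have "(r \<inter> D \<times> D) `` {a} = fibre (F a)" if "a \<in> D" for a
    using assms that by (auto simp: fibre_def)
  then have "fibre ` F ` D = D // (r \<inter> D \<times> D)"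
    by (auto simp: quotient_def)
  ultimately have "bij_betw fibre (F ` D) (D // (r \<inter> D \<times> D))"
    unfolding bij_betw_def by (rule conjI)
  then show ?thesis
    by (intro exI) (rule bij_betw_inv_into)
qed

theorem proposition6p7:
  assumes "CARD('n::finite) \<ge> 2"
    and "CARD('m::finite) = CARD('n) + 2"
  shows "(\<exists>f. bij_betw f (diag_classes :: (complex ^ 'm) bracket set set)
                (semisimple_orbits :: (complex ^ 'n \<Rightarrow> complex ^ 'n) set set set)) \<and>
         (\<exists>g. bij_betw g (reduced_diag_classes :: (complex ^ 'm) bracket set set)
                (semisimple_invertible_orbits :: (complex ^ 'n \<Rightarrow> complex ^ 'n) set set set))"
proof -
  define orbit where "orbit C = line_orbit (map_line C)" for C :: "complex ^ 'n \<Rightarrow> complex ^ 'n"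
  \<comment> \<open>The choice of a presenting map is harmless: two maps that present the same bracket have the same
  orbit, by reflexivity of isometric isomorphism.\<close>
  define rep :: "(complex ^ 'm) bracket \<Rightarrow> complex ^ 'n \<Rightarrow> complex ^ 'n"
    where "rep br = (SOME C. presents br C)" for br
  define F where "F br = orbit (rep br)" for br
  have rep: "presents br (rep br)" if "br \<in> diag_structures" for br
    unfolding rep_def using diag_structures_presents[OF assms(2) that] by (rule someI_ex)
  have orbit_eq_iff: "orbit C = orbit C' \<longleftrightarrow> i_isomorphic canonical_form br canonical_form br'"
    if "presents br C" "presents br' C'" for C C' and br br' :: "(complex ^ 'm) bracket"
  proof -
    have "C' \<noteq> (\<lambda>x. 0)"
      using that(2) by (simp add: presents_def semisimple_skew_def)
    then show ?thesis
      using i_isomorphic_iff_conjugate[OF that] by (simp add: orbit_def line_orbit_eq_iff_conjugate)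
  qed
  have iso_iff: "(br, br') \<in> i_iso_rel \<longleftrightarrow> F br = F br'"
    if "br \<in> diag_structures" "br' \<in> diag_structures" for br br'
    using orbit_eq_iff[OF rep[OF that(1)] rep[OF that(2)]] by (simp add: F_def i_iso_rel_def)
  have F_orbit: "F br = orbit C" if "presents br C" for br C
  proof -
    have "i_isomorphic canonical_form br canonical_form br"
      using orbit_eq_iff[OF that that] by simp
    then show ?thesis
      using orbit_eq_iff[OF rep[OF presents_diag_structures[OF that]] that] by (simp add: F_def)
  qed
  have "F ` diag_structures = orbit ` semisimple_skew"
  proof (intro equalityI image_subsetI)
    show "F br \<in> orbit ` semisimple_skew" if "br \<in> diag_structures" for br
      using rep[OF that] by (auto simp: F_def presents_def)
    show "orbit C \<in> F ` diag_structures" if "C \<in> semisimple_skew" for C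
      using presents_exists[OF assms(2) that] F_orbit presents_diag_structures by (metis imageI)
  qed
  moreover have "F ` reduced_diag_structures = orbit ` {C \<in> semisimple_skew. bij C}"
  proof (intro equalityI image_subsetI)
    show "F br \<in> orbit ` {C \<in> semisimple_skew. bij C}" if "br \<in> reduced_diag_structures" for br
    proof -
      have "presents br (rep br)" "reduced canonical_form br"
        using that rep by (auto simp: reduced_diag_structures_def)
      then have "rep br \<in> semisimple_skew" "bij (rep br)"
        using presents_reduced_iff[of br "rep br"] by (auto simp: presents_def)
      then show ?thesis by (simp add: F_def)
    qed
    show "orbit C \<in> F ` reduced_diag_structures" if "C \<in> {C \<in> semisimple_skew. bij C}" for C
    proof -
      obtain br :: "(complex ^ 'm) bracket" where br: "presents br C"
        using presents_exists[OF assms(2), of C] \<open>C \<in> _\<close> by blast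
      then have "br \<in> reduced_diag_structures"
        using that presents_diag_structures[OF br] presents_reduced_iff[OF br]
        by (simp add: reduced_diag_structures_def)
      then show ?thesis using F_orbit[OF br] by (metis imageI)
    qed
  qed
  moreover have "\<exists>f. bij_betw f (diag_classes :: (complex ^ 'm) bracket set set) (F ` diag_structures)"
    unfolding diag_classes_def by (rule quotient_bij_invariant) (rule iso_iff)
  moreover have "\<exists>f. bij_betw f (reduced_diag_classes :: (complex ^ 'm) bracket set set)
      (F ` reduced_diag_structures)"
    unfolding reduced_diag_classes_def
    by (rule quotient_bij_invariant) (auto intro!: iso_iff simp: reduced_diag_structures_def)
  ultimately show ?thesis
    unfolding semisimple_orbits_eq semisimple_invertible_orbits_eq orbit_def[symmetric] by simp
qed

end
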